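(* Let $A$ be a real $m\times n$ matrix and let switching costs be uniform, i.e. $S=(s_{ij})$ is the $n\times n$ matrix with $s_{ij}=1$ for $i\ne j$ and $s_{ii}=0$. Then there exist $K\in\mathbb N$ and $0=c_0<c_1<c_2<\dots<c_K<c_{K+1}=\infty$ such that for each $i\in\{0,\dots,K\}$ there exists a static strategy $y_i\in\Delta(\{1,\dots,n\})$ of Player 2, not depending on $c$, that achieves the minimax value in static strategies for every finite $c\in[c_i,c_{i+1}]$, i.e. $\max_{x\in\Delta(\{1,\dots,m\})}\{x^TAy_i+c\,y_i^TSy_i\}=\tilde v(c)$.
   Context: In the repeated zero-sum game with switching costs $(A,S,c)$, $c\ge0$, Player 2 (column player, minimizer) pays Player 1 (row player, maximizer) at each stage $t$ the amount $a_{i(t)j(t)}+c\,s_{j(t-1)j(t)}$, and payoffs are long-run averages. A static strategy plays the same mixed action at every stage, regardless of history. If Player 1 uses the static strategy $x\in\Delta(\{1,\dots,m\})$ and Player 2 the static strategy $y\in\Delta(\{1,\dots,n\})$, the payoff is $x^TAy+c\,y^TSy$, and the minimax value in static strategies is $$\tilde v(c)=\min_{y\in\Delta(\{1,\dots,n\})}\ \max_{x\in\Delta(\{1,\dots,m\})}\{x^TAy+c\,y^TSy\}.$$ *)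

theory Defs
  imports "HOL-Analysis.Analysis"
begin

definition prob_simplex :: "(real ^ 'k) set" where
  "prob_simplex = {x. (\<forall>i. 0 \<le> x $ i) \<and> (\<Sum>i\<in>UNIV. x $ i) = 1}"

definition static_payoff ::
    "real ^ 'n ^ 'm \<Rightarrow> real ^ 'n ^ 'n \<Rightarrow> real \<Rightarrow> real ^ 'm \<Rightarrow> real ^ 'n \<Rightarrow> real" where
  "static_payoff A S c x y = x \<bullet> (A *v y) + c * (y \<bullet> (S *v y))"

definition static_guarantee ::
    "real ^ 'n ^ 'm \<Rightarrow> real ^ 'n ^ 'n \<Rightarrow> real \<Rightarrow> real ^ 'n \<Rightarrow> real" where
  "static_guarantee A S c y = (SUP x\<in>prob_simplex. static_payoff A S c x y)"

definition static_minimax_value ::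
    "real ^ 'n ^ 'm \<Rightarrow> real ^ 'n ^ 'n \<Rightarrow> real \<Rightarrow> real" where
  "static_minimax_value A S c = (INF y\<in>prob_simplex. static_guarantee A S c y)"

definition uniform_switching_costs :: "real ^ 'n ^ 'n" where
  "uniform_switching_costs = (\<chi> i j. if i = j then 0 else 1)"

text \<open>The supremum and the infimum above are a maximum and a minimum.\<close>

lemma axis_in_prob_simplex: "axis i 1 \<in> prob_simplex"
  by (auto simp: prob_simplex_def axis_def)

lemma prob_simplex_nonempty: "prob_simplex \<noteq> {}"
  using axis_in_prob_simplex by blast

lemma compact_prob_simplex: "compact (prob_simplex :: (real ^ 'k) set)"
proof -
  have "closed (prob_simplex :: (real ^ 'k) set)"
  proof -
    have "closed {x :: real ^ 'k. 0 \<le> x $ i}" for i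
      by (intro closed_Collect_le continuous_intros)
    moreover have "closed {x :: real ^ 'k. (\<Sum>i\<in>UNIV. x $ i) = 1}"
      by (intro closed_Collect_eq continuous_intros)
    moreover have "prob_simplex = (\<Inter>i. {x :: real ^ 'k. 0 \<le> x $ i}) \<inter> {x. (\<Sum>i\<in>UNIV. x $ i) = 1}"
      by (auto simp: prob_simplex_def)
    ultimately show ?thesis
      by (metis closed_INT closed_Int)
  qed
  moreover have "norm x \<le> 1" if "x \<in> prob_simplex" for x :: "real ^ 'k"
    using norm_le_l1_cart[of x] that by (simp add: prob_simplex_def)
  then have "bounded (prob_simplex :: (real ^ 'k) set)"
    by (auto simp: bounded_iff)
  ultimately show ?thesis
    by (simp add: compact_eq_bounded_closed)
qed

lemma static_guarantee_attained:
  "\<exists>x\<in>prob_simplex. static_payoff A S c x y = static_guarantee A S c y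
      \<and> (\<forall>x'\<in>prob_simplex. static_payoff A S c x' y \<le> static_payoff A S c x y)"
proof -
  have "continuous_on prob_simplex (\<lambda>x. static_payoff A S c x y)"
    unfolding static_payoff_def by (intro continuous_intros)
  then obtain x where x: "x \<in> prob_simplex"
    "\<forall>x'\<in>prob_simplex. static_payoff A S c x' y \<le> static_payoff A S c x y"
    using continuous_attains_sup[OF compact_prob_simplex prob_simplex_nonempty] by blast
  then have "static_guarantee A S c y = static_payoff A S c x y"
    unfolding static_guarantee_def by (intro cSup_eq_maximum) auto
  with x show ?thesis
    by metis
qed

lemma static_guarantee_eq_Max:
  "static_guarantee A S c y = Max (range (\<lambda>i. (A *v y) $ i)) + c * (y \<bullet> (S *v y))"
proof -
  let ?M = "Max (range (\<lambda>i. (A *v y) $ i))"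
  have le: "static_payoff A S c x y \<le> ?M + c * (y \<bullet> (S *v y))" if "x \<in> prob_simplex" for x
  proof -
    have "x \<bullet> (A *v y) \<le> (\<Sum>i\<in>UNIV. x $ i * ?M)"
      unfolding inner_vec_def using that
      by (auto intro!: sum_mono mult_left_mono simp: prob_simplex_def)
    also have "\<dots> = ?M"
      using that by (simp add: prob_simplex_def flip: sum_distrib_right)
    finally show ?thesis
      by (simp add: static_payoff_def)
  qed
  have "?M \<in> range (\<lambda>i. (A *v y) $ i)"
    by (intro Max_in) auto
  then obtain i where "?M = (A *v y) $ i"
    by blast
  then have "static_payoff A S c (axis i 1) y = ?M + c * (y \<bullet> (S *v y))"
    by (simp add: static_payoff_def inner_axis')
  then show ?thesis
    unfolding static_guarantee_def using le axis_in_prob_simplex[of i]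
    by (intro cSup_eq_maximum) (auto intro: rev_image_eqI)
qed

lemma continuous_on_static_guarantee: "continuous_on X (static_guarantee A S c)"
proof -
  have Max: "continuous_on X (\<lambda>y. Max ((\<lambda>i. (A *v y) $ i) ` I))" if "finite I" "I \<noteq> {}" for I
    using that
  proof (induction I rule: finite_ne_induct)
    case (singleton i)
    then show ?case
      by (auto intro!: continuous_intros)
  next
    case (insert i I)
    then show ?case
      by (auto intro!: continuous_intros)
  qed
  have "static_guarantee A S c = (\<lambda>y. Max (range (\<lambda>i. (A *v y) $ i)) + c * (y \<bullet> (S *v y)))"
    by (rule ext) (rule static_guarantee_eq_Max)
  then show ?thesis
    using Max[of UNIV] by (auto intro!: continuous_intros)
qed

lemma static_minimax_value_attained:
  "\<exists>y\<in>prob_simplex. static_guarantee A S c y = static_minimax_value A S c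
      \<and> (\<forall>y'\<in>prob_simplex. static_guarantee A S c y \<le> static_guarantee A S c y')"
proof -
  obtain y where y: "y \<in> prob_simplex"
    "\<forall>y'\<in>prob_simplex. static_guarantee A S c y \<le> static_guarantee A S c y'"
    using continuous_attains_inf[OF compact_prob_simplex prob_simplex_nonempty
        continuous_on_static_guarantee] by blast
  then have "static_minimax_value A S c = static_guarantee A S c y"
    unfolding static_minimax_value_def by (intro cInf_eq_minimum) auto
  with y show ?thesis
    by metis
qed

end

theory Submission
  imports Defs
begin

text \<open>
  Under uniform switching costs a static strategy \<open>y\<close> switches with probability \<open>1 - y \<bullet> y\<close>,
  so its guarantee is \<open>max\<^sub>k (A y)\<^sub>k + t (1 - y \<bullet> y)\<close>. Cut the simplex into the best reply regions,
  on which a fixed row \<open>i\<close> attains the maximum. They are polytopes that do not depend on the cost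
  \<open>t\<close>, and on each of them the guarantee is an affine function minus \<open>t (y \<bullet> y)\<close>, hence concave
  for \<open>t \<ge> 0\<close>. A concave function on a polytope is minimal at a vertex, so the finitely many
  vertices of all regions contain an optimal strategy for every \<open>t \<ge> 0\<close>
  (\<open>finite_optimal_strategies\<close>).

  The guarantee of a fixed vertex is affine in \<open>t\<close>. Hence the minimax value is the lower envelope
  of finitely many lines, and two lines can exchange their order only at a crossing. Between two
  consecutive crossing points a single vertex therefore stays optimal, up to and including the end
  points (\<open>line_minimal_between_crossings\<close>).
\<close>

section \<open>Finitely many candidate strategies\<close>

lemma switching_probability:
  fixes y :: "real ^ 'n"
  assumes "y \<in> prob_simplex"
  shows "y \<bullet> (uniform_switching_costs *v y) = 1 - y \<bullet> y"
proof -
  have "(uniform_switching_costs *v y) $ i = 1 - y $ i" for i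
  proof -
    have "(uniform_switching_costs *v y) $ i = (\<Sum>j\<in>UNIV. y $ j - (if j = i then y $ j else 0))"
      unfolding matrix_vector_mult_def uniform_switching_costs_def
      by (auto intro!: sum.cong)
    then show ?thesis
      using assms by (simp add: sum_subtractf prob_simplex_def)
  qed
  then have "y \<bullet> (uniform_switching_costs *v y) = (\<Sum>i\<in>UNIV. y $ i - y $ i * y $ i)"
    by (simp add: inner_vec_def right_diff_distrib)
  then show ?thesis
    using assms by (simp add: sum_subtractf prob_simplex_def inner_vec_def)
qed

definition best_reply_region :: "real ^ 'n ^ 'm \<Rightarrow> 'm \<Rightarrow> (real ^ 'n) set" where
  "best_reply_region A i = {y \<in> prob_simplex. \<forall>k. (A *v y) $ k \<le> (A *v y) $ i}"

lemma static_guarantee_on_best_reply_region: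
  assumes "y \<in> best_reply_region A i"
  shows "static_guarantee A uniform_switching_costs t y = (A *v y) $ i + t * (1 - y \<bullet> y)"
proof -
  have "Max (range (\<lambda>k. (A *v y) $ k)) = (A *v y) $ i"
    using assms by (intro Max_eqI) (auto simp: best_reply_region_def)
  then show ?thesis
    using assms by (simp add: static_guarantee_eq_Max switching_probability best_reply_region_def)
qed

lemma prob_simplex_covered_by_best_reply_regions:
  fixes A :: "real ^ 'n ^ 'm"
  assumes "y \<in> prob_simplex"
  obtains i where "y \<in> best_reply_region A i"
proof -
  have "Max (range (\<lambda>k. (A *v y) $ k)) \<in> range (\<lambda>k. (A *v y) $ k)"
    by (intro Max_in) auto
  then obtain i where "(A *v y) $ i = Max (range (\<lambda>k. (A *v y) $ k))"
    by (metis imageE)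
  then have "y \<in> best_reply_region A i"
    using assms by (simp add: best_reply_region_def)
  then show ?thesis
    by (rule that)
qed

lemma polytope_best_reply_region:
  fixes A :: "real ^ 'n ^ 'm"
  shows "polytope (best_reply_region A i)"
proof -
  let ?nonneg = "\<Inter>k. {y :: real ^ 'n. axis k 1 \<bullet> y \<ge> 0}"
  let ?total = "{y :: real ^ 'n. (\<chi> k. 1) \<bullet> y = 1}"
  let ?best = "\<Inter>k. {y :: real ^ 'n. (A $ k - A $ i) \<bullet> y \<le> 0}"
  have "best_reply_region A i = ?nonneg \<inter> ?total \<inter> ?best"
    by (auto simp: best_reply_region_def prob_simplex_def inner_axis' inner_diff_left
        matrix_vector_mul_component inner_vec_def[of "\<chi> k. 1"])
  moreover have "polyhedron ?nonneg" "polyhedron ?best"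
    by (auto intro!: polyhedron_Inter polyhedron_halfspace_ge polyhedron_halfspace_le)
  ultimately have "polyhedron (best_reply_region A i)"
    by (simp add: polyhedron_hyperplane)
  moreover have "bounded (best_reply_region A i)"
    by (rule bounded_subset[OF compact_imp_bounded[OF compact_prob_simplex]])
      (auto simp: best_reply_region_def)
  ultimately show ?thesis
    by (simp add: polytope_eq_bounded_polyhedron)
qed

lemma convex_on_inner_self: "convex S \<Longrightarrow> convex_on S (\<lambda>y :: 'a :: real_inner. y \<bullet> y)"
proof (rule convex_onI)
  fix s :: real and x y :: 'a
  assume "0 < s" "s < 1"
  then have "0 \<le> s * (1 - s) * ((x - y) \<bullet> (x - y))"
    by simp
  also have "\<dots> = (1 - s) * (x \<bullet> x) + s * (y \<bullet> y)
      - ((1 - s) *\<^sub>R x + s *\<^sub>R y) \<bullet> ((1 - s) *\<^sub>R x + s *\<^sub>R y)"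
    by (simp add: inner_commute algebra_simps)
  finally show "((1 - s) *\<^sub>R x + s *\<^sub>R y) \<bullet> ((1 - s) *\<^sub>R x + s *\<^sub>R y)
      \<le> (1 - s) * (x \<bullet> x) + s * (y \<bullet> y)"
    by simp
qed

text \<open>By the Krein-Milman theorem every point is a convex combination of extreme points, and a
  convex function at such a combination is at most its largest value at the points combined.\<close>

lemma convex_on_polytope_max_extreme_point:
  fixes P :: "'a :: euclidean_space set"
  assumes "polytope P" "convex_on P f" "y \<in> P"
  obtains v where "v extreme_point_of P" "f y \<le> f v"
proof -
  let ?E = "{v. v extreme_point_of P}"
  have hull: "P = convex hull ?E"
    using assms(1) by (intro Krein_Milman_Minkowski polytope_imp_compact polytope_imp_convex)
  have fin: "finite ?E"
    using assms(1) by (intro finite_polyhedron_extreme_points polytope_imp_polyhedron)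
  have ne: "?E \<noteq> {}"
    using hull assms(3) by (metis convex_hull_empty empty_iff)
  have "\<forall>x\<in>convex hull ?E. f x \<le> Max (f ` ?E)"
    using assms(2) hull fin by (intro convex_on_convex_hull_bound) auto
  then have "f y \<le> Max (f ` ?E)"
    using hull assms(3) by blast
  moreover have "Max (f ` ?E) \<in> f ` ?E"
    using fin ne by (intro Max_in) auto
  ultimately show ?thesis
    using that by auto
qed

lemma best_reply_region_optimal_vertex:
  fixes A :: "real ^ 'n ^ 'm"
  assumes "0 \<le> t" "y \<in> best_reply_region A i"
  obtains v where "v extreme_point_of best_reply_region A i"
    "static_guarantee A uniform_switching_costs t v \<le> static_guarantee A uniform_switching_costs t y"
proof -
  let ?P = "best_reply_region A i"
  \<comment> \<open>On this region the guarantee is \<open>- ?f\<close>, so a maximum of the convex \<open>?f\<close> minimises it.\<close>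
  let ?f = "\<lambda>y. t * (y \<bullet> y) + (- (A $ i) \<bullet> y + (- t))"
  have conv: "convex ?P"
    by (rule polytope_imp_convex[OF polytope_best_reply_region])
  have "convex_on ?P (\<lambda>y. - (A $ i) \<bullet> y + (- t))"
    using conv by (intro convex_onI) (auto simp: algebra_simps)
  then have "convex_on ?P ?f"
    by (rule convex_on_add[OF convex_on_cmul[OF assms(1) convex_on_inner_self[OF conv]]])
  then obtain v where v: "v extreme_point_of ?P" "?f y \<le> ?f v"
    using convex_on_polytope_max_extreme_point[OF polytope_best_reply_region _ assms(2)] by blast
  then have "v \<in> ?P"
    by (simp add: extreme_point_of_def)
  with v assms(2) have "static_guarantee A uniform_switching_costs t v
      \<le> static_guarantee A uniform_switching_costs t y"
    by (simp add: static_guarantee_on_best_reply_region matrix_vector_mul_component algebra_simps)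
  with v(1) show ?thesis
    by (rule that)
qed

lemma finite_optimal_strategies:
  fixes A :: "real ^ 'n ^ 'm"
  obtains V where "finite V" "V \<noteq> {}" "V \<subseteq> prob_simplex"
    "\<And>t y. 0 \<le> t \<Longrightarrow> y \<in> prob_simplex \<Longrightarrow> \<exists>v\<in>V. static_guarantee A uniform_switching_costs t v
      \<le> static_guarantee A uniform_switching_costs t y"
proof
  let ?V = "\<Union>i. {v. v extreme_point_of best_reply_region A i}"
  show "finite ?V"
    by (auto intro: finite_polyhedron_extreme_points polytope_imp_polyhedron
        polytope_best_reply_region)
  show "?V \<subseteq> prob_simplex"
    by (auto simp: extreme_point_of_def best_reply_region_def)
  show opt: "\<exists>v\<in>?V. static_guarantee A uniform_switching_costs t v
      \<le> static_guarantee A uniform_switching_costs t y"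
    if t: "0 \<le> t" and y: "y \<in> prob_simplex" for t y
  proof -
    obtain i where "y \<in> best_reply_region A i"
      using y by (rule prob_simplex_covered_by_best_reply_regions)
    then obtain v where "v extreme_point_of best_reply_region A i"
      "static_guarantee A uniform_switching_costs t v
        \<le> static_guarantee A uniform_switching_costs t y"
      by (rule best_reply_region_optimal_vertex[OF t])
    then show ?thesis
      by blast
  qed
  show "?V \<noteq> {}"
    using opt[of 0] prob_simplex_nonempty by blast
qed

section \<open>Lower envelopes of lines\<close>

definition crossing_points :: "('a \<Rightarrow> real) \<Rightarrow> ('a \<Rightarrow> real) \<Rightarrow> 'a set \<Rightarrow> real set" where
  "crossing_points a b V = {t. \<exists>u\<in>V. \<exists>v\<in>V. b u \<noteq> b v \<and> a u + t * b u = a v + t * b v}"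

lemma finite_crossing_points:
  assumes "finite V"
  shows "finite (crossing_points a b V)"
proof (rule finite_subset)
  show "crossing_points a b V \<subseteq> (\<lambda>(u, v). (a v - a u) / (b u - b v)) ` (V \<times> V)"
  proof
    fix t assume "t \<in> crossing_points a b V"
    then obtain u v where "u \<in> V" "v \<in> V" "b u \<noteq> b v" "a u + t * b u = a v + t * b v"
      by (auto simp: crossing_points_def)
    moreover from this have "t = (a v - a u) / (b u - b v)"
      by (simp add: field_simps)
    ultimately show "t \<in> (\<lambda>(u, v). (a v - a u) / (b u - b v)) ` (V \<times> V)"
      by force
  qed
qed (use assms in auto)

text \<open>If the line of \<open>u\<close> were below that of \<open>v\<close> at \<open>t\<close>, but not at the inner point \<open>s\<close>, the two
  would cross between \<open>t\<close> and \<open>s\<close>, with \<open>t\<close> excluded. Such a point lies strictly inside the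
  interval even if \<open>t\<close> is one of its end points.\<close>

lemma line_minimal_between_crossings:
  fixes a b :: "'a \<Rightarrow> real" and lo hi :: ereal
  assumes no_crossing: "\<And>r. r \<in> crossing_points a b V \<Longrightarrow> \<not> (lo < ereal r \<and> ereal r < hi)"
    and V: "u \<in> V" "v \<in> V"
    and s: "lo < ereal s" "ereal s < hi" "a v + s * b v \<le> a u + s * b u"
    and t: "lo \<le> ereal t" "ereal t \<le> hi"
  shows "a v + t * b v \<le> a u + t * b u"
proof (rule ccontr)
  define d where "d r = (a u - a v) + r * (b u - b v)" for r
  assume "\<not> ?thesis"
  then have neg: "d t < 0"
    by (simp add: d_def algebra_simps)
  have pos: "0 \<le> d s"
    using s(3) by (simp add: d_def algebra_simps)
  have slope: "b u \<noteq> b v"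
    using neg pos by (auto simp: d_def)
  have cont: "continuous_on X d" for X
    unfolding d_def by (intro continuous_intros)
  have "\<exists>r. d r = 0 \<and> (t < r \<and> r \<le> s \<or> s \<le> r \<and> r < t)"
  proof (cases "t \<le> s")
    case True
    then show ?thesis
      using IVT'[of d t 0 s] neg pos cont by (metis less_eq_real_def less_irrefl)
  next
    case False
    then show ?thesis
      using IVT2'[of d t 0 s] neg pos cont by (metis less_eq_real_def less_irrefl nle_le)
  qed
  then obtain r where r: "d r = 0" "t < r \<and> r \<le> s \<or> s \<le> r \<and> r < t"
    by blast
  have "a u + r * b u = a v + r * b v"
    using r(1) by (simp add: d_def algebra_simps)
  then have "r \<in> crossing_points a b V"
    using V slope by (auto simp: crossing_points_def)
  moreover have "lo < ereal r \<and> ereal r < hi"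
    using r(2)
  proof
    assume "t < r \<and> r \<le> s"
    then show ?thesis
      using s(2) t(1) by (metis ereal_less_eq(3) less_ereal.simps(1) order_le_less_trans)
  next
    assume "s \<le> r \<and> r < t"
    then show ?thesis
      using s(1) t(2) by (metis ereal_less_eq(3) less_ereal.simps(1) order_less_le_trans)
  qed
  ultimately show False
    using no_crossing by blast
qed

lemma finite_set_partitions_halfline:
  fixes B :: "real set"
  assumes "finite B"
  obtains K :: nat and c :: "nat \<Rightarrow> ereal" where
    "c 0 = 0" "c (K + 1) = \<infinity>" "\<And>i. i \<le> K \<Longrightarrow> 0 \<le> c i" "\<And>i. i \<le> K \<Longrightarrow> c i < c (i + 1)"
    "\<And>i r. i \<le> K \<Longrightarrow> r \<in> B \<Longrightarrow> \<not> (c i < ereal r \<and> ereal r < c (i + 1))"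
proof -
  define C where "C = insert 0 {r \<in> B. 0 < r}"
  define xs where "xs = sorted_list_of_set C"
  define K where "K = length xs - 1"
  define c where "c i = (if i \<le> K then ereal (xs ! i) else \<infinity>)" for i
  have "finite C"
    using assms by (simp add: C_def)
  then have set: "set xs = C" and sorted: "sorted_wrt (<) xs"
    by (simp_all add: xs_def)
  have "xs \<noteq> []"
    using set by (auto simp: C_def)
  then have len: "length xs = Suc K"
    by (simp add: K_def)
  have less: "xs ! i < xs ! j" if "i < j" "j \<le> K" for i j
    using sorted_wrt_nth_less[OF sorted that(1)] that(2) len by simp
  have idx: "\<exists>j\<le>K. xs ! j = r" if "r \<in> C" for r
    using that set len by (metis in_set_conv_nth less_Suc_eq_le)
  have nonneg: "0 \<le> xs ! i" if "i \<le> K" for i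
    using nth_mem[of i xs] that len set by (auto simp: C_def)
  show ?thesis
  proof
    obtain j where "j \<le> K" "xs ! j = 0"
      using idx[of 0] by (auto simp: C_def)
    then have "xs ! 0 = 0"
      using less[of 0 j] nonneg[of 0] by (cases "j = 0") auto
    then show "c 0 = 0"
      by (simp add: c_def zero_ereal_def)
    show "c (K + 1) = \<infinity>"
      by (simp add: c_def)
    show "0 \<le> c i" if "i \<le> K" for i
      using nonneg[OF that] that by (simp add: c_def)
    show "c i < c (i + 1)" if "i \<le> K" for i
      using less[of i "i + 1"] that by (simp add: c_def)
    show "\<not> (c i < ereal r \<and> ereal r < c (i + 1))" if i: "i \<le> K" and r: "r \<in> B" for i r
    proof
      assume between: "c i < ereal r \<and> ereal r < c (i + 1)"
      then have lower: "xs ! i < r"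
        using i by (simp add: c_def)
      then have "r \<in> C"
        using nonneg[OF i] r by (simp add: C_def)
      then obtain j where j: "j \<le> K" "xs ! j = r"
        using idx by blast
      have "i < j"
        using less[of j i] lower j i by (metis linorder_neqE_nat order_less_asym order_less_irrefl)
      then have "xs ! (i + 1) \<le> r" "i + 1 \<le> K"
        using less[of "i + 1" j] j by (cases "j = i + 1"; force)+
      then show False
        using between by (simp add: c_def)
    qed
  qed
qed

section \<open>Optimal static strategies for ranges of costs\<close>

theorem corollary2:
  fixes A :: "real ^ 'n ^ 'm"
  shows "\<exists>(K :: nat) (c :: nat \<Rightarrow> ereal).
    c 0 = 0 \<and> c (K + 1) = \<infinity> \<and> (\<forall>i\<le>K. c i < c (i + 1)) \<and>
    (\<forall>i\<le>K. \<exists>y \<in> prob_simplex. \<forall>t :: real.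
       c i \<le> ereal t \<and> ereal t \<le> c (i + 1) \<longrightarrow>
       (SUP x\<in>prob_simplex. static_payoff A uniform_switching_costs t x y)
         = static_minimax_value A uniform_switching_costs t)"
proof -
  let ?S = "uniform_switching_costs :: real ^ 'n ^ 'n"
  obtain V where V: "finite V" "V \<noteq> {}" "V \<subseteq> prob_simplex"
    and opt: "\<And>t y. 0 \<le> t \<Longrightarrow> y \<in> prob_simplex \<Longrightarrow>
      \<exists>v\<in>V. static_guarantee A ?S t v \<le> static_guarantee A ?S t y"
    by (rule finite_optimal_strategies[of A]) blast
  define a where "a y = Max (range (\<lambda>k. (A *v y) $ k))" for y
  define b where "b y = y \<bullet> (?S *v y)" for y
  have line: "static_guarantee A ?S t y = a y + t * b y" for t y
    by (simp add: static_guarantee_eq_Max a_def b_def)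
  obtain K :: nat and c :: "nat \<Rightarrow> ereal" where c: "c 0 = 0" "c (K + 1) = \<infinity>" "\<And>i. i \<le> K \<Longrightarrow> 0 \<le> c i"
    "\<And>i. i \<le> K \<Longrightarrow> c i < c (i + 1)"
    and no_crossing: "\<And>i r. i \<le> K \<Longrightarrow> r \<in> crossing_points a b V \<Longrightarrow>
      \<not> (c i < ereal r \<and> ereal r < c (i + 1))"
    by (rule finite_set_partitions_halfline[OF finite_crossing_points[OF V(1), of a b]])
      blast
  have "\<exists>y\<in>prob_simplex. \<forall>t. c i \<le> ereal t \<and> ereal t \<le> c (i + 1) \<longrightarrow>
      (SUP x\<in>prob_simplex. static_payoff A ?S t x y) = static_minimax_value A ?S t"
    if i: "i \<le> K" for i
  proof -
    obtain s where s: "c i < ereal s" "ereal s < c (i + 1)"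
      using ereal_dense2[OF c(4)[OF i]] by blast
    \<comment> \<open>A vertex that is best at one inner point of the interval stays best on all of it.\<close>
    obtain v where v: "v \<in> V" "\<And>u. u \<in> V \<Longrightarrow> a v + s * b v \<le> a u + s * b u"
      using V(1,2) arg_min_if_finite(1)[of V "\<lambda>u. a u + s * b u"]
        arg_min_least[of V _ "\<lambda>u. a u + s * b u"] by blast
    have "static_guarantee A ?S t v = static_minimax_value A ?S t"
      if t: "c i \<le> ereal t" "ereal t \<le> c (i + 1)" for t
    proof -
      have "0 \<le> ereal t"
        using c(3)[OF i] t(1) by (rule order_trans)
      then have "0 \<le> t"
        by simp
      obtain y where y: "y \<in> prob_simplex"
        "static_guarantee A ?S t y = static_minimax_value A ?S t"
        "\<And>y'. y' \<in> prob_simplex \<Longrightarrow> static_guarantee A ?S t y \<le> static_guarantee A ?S t y'"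
        using static_minimax_value_attained by metis
      obtain u where u: "u \<in> V" "static_guarantee A ?S t u \<le> static_guarantee A ?S t y"
        using opt[OF \<open>0 \<le> t\<close> y(1)] by blast
      have "static_guarantee A ?S t v \<le> static_guarantee A ?S t u"
        unfolding line
        using line_minimal_between_crossings[OF no_crossing[OF i] u(1) v(1) s v(2)[OF u(1)] t] .
      then show ?thesis
        using u(2) y(2) y(3)[of v] v(1) V(3) by auto
    qed
    then show ?thesis
      using v(1) V(3) unfolding static_guarantee_def by blast
  qed
  then show ?thesis
    using c by blast
qed

end
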